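(* For all finite sets $\Gamma_1,\Gamma_2$ of formulas, every finite multiset $\Delta$ of formulas and every formula $A$: if $(\Gamma_1;A)\preceq_s(\Gamma_2;\Delta)$, then the sequent $\Gamma_2;\Delta\vdash A$ is derivable.
   Context: Formulas: $A,B,C ::= a \mid \mathbf{1} \mid A\otimes B \mid \top \mid A \,\&\, B \mid a \multimap B \mid\ !A$, with $a$ ranging over atomic formulas. Contexts $\Gamma,\Delta$ are finite multisets of formulas; "$\Delta_1,\Delta_2$" is multiset union, "$\cdot$" the empty context. Sequents $\Gamma;\Delta\vdash A$ are derivable by the rules: (init) $\Gamma;a\vdash a$. (clone) from $\Gamma,A;\Delta,A\vdash C$ infer $\Gamma,A;\Delta\vdash C$. ($\otimes$R) from $\Gamma;\Delta_1\vdash A$ and $\Gamma;\Delta_2\vdash B$ infer $\Gamma;\Delta_1,\Delta_2\vdash A\otimes B$. ($\otimes$L) from $\Gamma;\Delta,A,B\vdash C$ infer $\Gamma;\Delta,A\otimes B\vdash C$. ($\mathbf 1$R) $\Gamma;\cdot\vdash\mathbf 1$. ($\mathbf 1$L) from $\Gamma;\Delta\vdash C$ infer $\Gamma;\Delta,\mathbf 1\vdash C$. ($\&$R) from $\Gamma;\Delta\vdash A$ and $\Gamma;\Delta\vdash B$ infer $\Gamma;\Delta\vdash A\&B$. ($\&$L$_i$, $i=1,2$) from $\Gamma;\Delta,A_i\vdash C$ infer $\Gamma;\Delta,A_1\&A_2\vdash C$. ($\top$R) $\Gamma;\Delta\vdash\top$ (no left rule for $\top$). ($\multimap$R) from $\Gamma;\Delta,a\vdash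 B$ infer $\Gamma;\Delta\vdash a\multimap B$. ($\multimap$L) from $\Gamma;\Delta_1\vdash a$ and $\Gamma;\Delta_2,B\vdash C$ infer $\Gamma;\Delta_1,\Delta_2,a\multimap B\vdash C$. (!R) from $\Gamma;\cdot\vdash A$ infer $\Gamma;\cdot\vdash\,!A$. (!L) from $\Gamma,A;\Delta\vdash C$ infer $\Gamma;\Delta,!A\vdash C$. States are pairs $(\Gamma;\Delta)$ modulo structural congruence $\equiv$: $\Delta$ is a multiset and $\Gamma$ a set ($(\Gamma,A,A;\Delta)\equiv(\Gamma,A;\Delta)$); congruent states are identified. Composition: $((\Gamma_1;\Delta_1),(\Gamma_2;\Delta_2)) := (\Gamma_1,\Gamma_2;\Delta_1,\Delta_2)$. $(\Gamma;A)$ denotes the state whose linear part is the single formula $A$. Labelled transitions with labels $\tau$, $!a$, $?a$ ($a$ atomic) are generated by: $(\Gamma;\Delta,a)\xrightarrow{!a}(\Gamma;\Delta)$; $(\Gamma;\Delta,a\multimap B)\xrightarrow{?a}(\Gamma;\Delta,B)$; if $S_1\xrightarrow{!a}S_1'$ and $S_2\xrightarrow{?a}S_2'$ then $(S_1,S_2)\xrightarrow{\tau}(S_1',S_2')$; $(\Gamma;\Delta,A\otimes B)\xrightarrow{\tau}(\Gamma;\Delta,A,B)$; $(\Gamma;\Delta,\mathbf 1)\xrightarrow{\tau}(\Gamma;\Delta)$; $(\Gamma;\Delta,A_1\&A_2)\xrightarrow{\tau}(\Gamma;\Delta,A_i)$; $(\Gamma;\Delta,!A)\xrightarrow{\tau}(\Gamma,A;\Delta)$;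 $(\Gamma,A;\Delta)\xrightarrow{\tau}(\Gamma,A;\Delta,A)$ (no rule for $\top$). $\alpha$ ranges over $\tau$ and $!a$. $\overset{\tau}{\Longrightarrow}$ is the reflexive transitive closure of $\xrightarrow{\tau}$; for $\beta\ne\tau$, $\overset{\beta}{\Longrightarrow}$ is $\overset{\tau}{\Longrightarrow}\xrightarrow{\beta}\overset{\tau}{\Longrightarrow}$. A relation $\mathcal R$ on states is a simulation if $(\Gamma_1;\Delta_1)\mathcal R(\Gamma_2;\Delta_2)$ implies: (1) if $(\Gamma_1;\Delta_1)\equiv(\Gamma_1';\cdot)$ then $(\Gamma_2;\Delta_2)\overset{\tau}{\Longrightarrow}(\Gamma_2';\cdot)$ with $(\Gamma_1';\cdot)\mathcal R(\Gamma_2';\cdot)$; (2) if $(\Gamma_1;\Delta_1)\equiv((\Gamma_1';\Delta_1'),(\Gamma_1'';\Delta_1''))$ then $(\Gamma_2;\Delta_2)\overset{\tau}{\Longrightarrow}((\Gamma_2';\Delta_2'),(\Gamma_2'';\Delta_2''))$ with $(\Gamma_1';\Delta_1')\mathcal R(\Gamma_2';\Delta_2')$ and $(\Gamma_1'';\Delta_1'')\mathcal R(\Gamma_2'';\Delta_2'')$; (3) if $(\Gamma_1;\Delta_1)\xrightarrow{\alpha}(\Gamma_1';\Delta_1')$ then $(\Gamma_2;\Delta_2)\overset{\alpha}{\Longrightarrow}(\Gamma_2';\Delta_2')$ with $(\Gamma_1';\Delta_1')\mathcal R(\Gamma_2';\Delta_2')$; (4) if $(\Gamma_1;\Delta_1)\xrightarrow{?a}(\Gamma_1';\Delta_1')$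 then $(\Gamma_2;\Delta_2,a)\overset{\tau}{\Longrightarrow}(\Gamma_2';\Delta_2')$ with $(\Gamma_1';\Delta_1')\mathcal R(\Gamma_2';\Delta_2')$. $S_1\preceq_s S_2$ iff some simulation relates $S_1$ to $S_2$. *)

theory Defs
  imports "HOL-Library.Multiset" "HOL-Library.FSet"
begin

datatype 'a form =
    Atom 'a
  | One
  | Tensor "'a form" "'a form"
  | Top
  | With "'a form" "'a form"
  | Lolli 'a "'a form"
  | Bang "'a form"

inductive derivable :: "'a form multiset \<Rightarrow> 'a form multiset \<Rightarrow> 'a form \<Rightarrow> bool" where
  init: "derivable \<Gamma> {#Atom a#} (Atom a)"
| clone: "derivable (add_mset A \<Gamma>) (add_mset A \<Delta>) C \<Longrightarrow> derivable (add_mset A \<Gamma>) \<Delta> C"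
| tensorR: "derivable \<Gamma> \<Delta>\<^sub>1 A \<Longrightarrow> derivable \<Gamma> \<Delta>\<^sub>2 B \<Longrightarrow> derivable \<Gamma> (\<Delta>\<^sub>1 + \<Delta>\<^sub>2) (Tensor A B)"
| tensorL: "derivable \<Gamma> (\<Delta> + {#A, B#}) C \<Longrightarrow> derivable \<Gamma> (add_mset (Tensor A B) \<Delta>) C"
| oneR: "derivable \<Gamma> {#} One"
| oneL: "derivable \<Gamma> \<Delta> C \<Longrightarrow> derivable \<Gamma> (add_mset One \<Delta>) C"
| withR: "derivable \<Gamma> \<Delta> A \<Longrightarrow> derivable \<Gamma> \<Delta> B \<Longrightarrow> derivable \<Gamma> \<Delta> (With A B)"
| withL1: "derivable \<Gamma> (add_mset A\<^sub>1 \<Delta>) C \<Longrightarrow> derivable \<Gamma> (add_mset (With A\<^sub>1 A\<^sub>2) \<Delta>) C"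
| withL2: "derivable \<Gamma> (add_mset A\<^sub>2 \<Delta>) C \<Longrightarrow> derivable \<Gamma> (add_mset (With A\<^sub>1 A\<^sub>2) \<Delta>) C"
| topR: "derivable \<Gamma> \<Delta> Top"
| lolliR: "derivable \<Gamma> (add_mset (Atom a) \<Delta>) B \<Longrightarrow> derivable \<Gamma> \<Delta> (Lolli a B)"
| lolliL: "derivable \<Gamma> \<Delta>\<^sub>1 (Atom a) \<Longrightarrow> derivable \<Gamma> (add_mset B \<Delta>\<^sub>2) C \<Longrightarrow>
    derivable \<Gamma> (add_mset (Lolli a B) (\<Delta>\<^sub>1 + \<Delta>\<^sub>2)) C"
| bangR: "derivable \<Gamma> {#} A \<Longrightarrow> derivable \<Gamma> {#} (Bang A)"
| bangL: "derivable (add_mset A \<Gamma>) \<Delta> C \<Longrightarrow> derivable \<Gamma> (add_mset (Bang A) \<Delta>) C"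

text \<open>
  Structural congruence identifies states that differ only in the multiplicities of their
  unrestricted formulas. A congruence class is thus a finite set paired with a multiset, and
  congruence of states becomes equality.
\<close>

type_synonym 'a state = "'a form fset \<times> 'a form multiset"

definition compose :: "'a state \<Rightarrow> 'a state \<Rightarrow> 'a state" where
  "compose S T = (fst S |\<union>| fst T, snd S + snd T)"

datatype 'a label = Tau | Out 'a | In 'a

inductive step :: "'a state \<Rightarrow> 'a label \<Rightarrow> 'a state \<Rightarrow> bool" where
  out: "step (\<Gamma>, add_mset (Atom a) \<Delta>) (Out a) (\<Gamma>, \<Delta>)"
| inp: "step (\<Gamma>, add_mset (Lolli a B) \<Delta>) (In a) (\<Gamma>, add_mset B \<Delta>)"
| sync: "step S\<^sub>1 (Out a) S\<^sub>1' \<Longrightarrow> step S\<^sub>2 (In a) S\<^sub>2' \<Longrightarrow>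
    step (compose S\<^sub>1 S\<^sub>2) Tau (compose S\<^sub>1' S\<^sub>2')"
| tensor: "step (\<Gamma>, add_mset (Tensor A B) \<Delta>) Tau (\<Gamma>, \<Delta> + {#A, B#})"
| one: "step (\<Gamma>, add_mset One \<Delta>) Tau (\<Gamma>, \<Delta>)"
| with1: "step (\<Gamma>, add_mset (With A\<^sub>1 A\<^sub>2) \<Delta>) Tau (\<Gamma>, add_mset A\<^sub>1 \<Delta>)"
| with2: "step (\<Gamma>, add_mset (With A\<^sub>1 A\<^sub>2) \<Delta>) Tau (\<Gamma>, add_mset A\<^sub>2 \<Delta>)"
| bang: "step (\<Gamma>, add_mset (Bang A) \<Delta>) Tau (finsert A \<Gamma>, \<Delta>)"
| copy: "step (finsert A \<Gamma>, \<Delta>) Tau (finsert A \<Gamma>, add_mset A \<Delta>)"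

definition tau_steps :: "'a state \<Rightarrow> 'a state \<Rightarrow> bool" where
  "tau_steps = (\<lambda>S T. step S Tau T)\<^sup>*\<^sup>*"

definition weak_step :: "'a state \<Rightarrow> 'a label \<Rightarrow> 'a state \<Rightarrow> bool" where
  "weak_step S \<beta> T \<longleftrightarrow>
     (if \<beta> = Tau then tau_steps S T
      else \<exists>S' T'. tau_steps S S' \<and> step S' \<beta> T' \<and> tau_steps T' T)"

definition simulation :: "('a state \<Rightarrow> 'a state \<Rightarrow> bool) \<Rightarrow> bool" where
  "simulation R \<longleftrightarrow> (\<forall>\<Gamma>\<^sub>1 \<Delta>\<^sub>1 \<Gamma>\<^sub>2 \<Delta>\<^sub>2. R (\<Gamma>\<^sub>1, \<Delta>\<^sub>1) (\<Gamma>\<^sub>2, \<Delta>\<^sub>2) \<longrightarrow>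
     (\<forall>\<Gamma>\<^sub>1'. (\<Gamma>\<^sub>1, \<Delta>\<^sub>1) = (\<Gamma>\<^sub>1', {#}) \<longrightarrow>
        (\<exists>\<Gamma>\<^sub>2'. tau_steps (\<Gamma>\<^sub>2, \<Delta>\<^sub>2) (\<Gamma>\<^sub>2', {#}) \<and> R (\<Gamma>\<^sub>1', {#}) (\<Gamma>\<^sub>2', {#}))) \<and>
     (\<forall>S\<^sub>1' S\<^sub>1''. (\<Gamma>\<^sub>1, \<Delta>\<^sub>1) = compose S\<^sub>1' S\<^sub>1'' \<longrightarrow>
        (\<exists>S\<^sub>2' S\<^sub>2''. tau_steps (\<Gamma>\<^sub>2, \<Delta>\<^sub>2) (compose S\<^sub>2' S\<^sub>2'') \<and> R S\<^sub>1' S\<^sub>2' \<and> R S\<^sub>1'' S\<^sub>2'')) \<and>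
     (\<forall>\<alpha> S\<^sub>1'. (\<alpha> = Tau \<or> (\<exists>a. \<alpha> = Out a)) \<longrightarrow> step (\<Gamma>\<^sub>1, \<Delta>\<^sub>1) \<alpha> S\<^sub>1' \<longrightarrow>
        (\<exists>S\<^sub>2'. weak_step (\<Gamma>\<^sub>2, \<Delta>\<^sub>2) \<alpha> S\<^sub>2' \<and> R S\<^sub>1' S\<^sub>2')) \<and>
     (\<forall>a S\<^sub>1'. step (\<Gamma>\<^sub>1, \<Delta>\<^sub>1) (In a) S\<^sub>1' \<longrightarrow>
        (\<exists>S\<^sub>2'. tau_steps (\<Gamma>\<^sub>2, add_mset (Atom a) \<Delta>\<^sub>2) S\<^sub>2' \<and> R S\<^sub>1' S\<^sub>2')))"

definition sim_preorder :: "'a state \<Rightarrow> 'a state \<Rightarrow> bool" (infix "\<preceq>\<^sub>s" 50) where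
  "S\<^sub>1 \<preceq>\<^sub>s S\<^sub>2 \<longleftrightarrow> (\<exists>R. simulation R \<and> R S\<^sub>1 S\<^sub>2)"

end

theory Submission
  imports Defs
begin

text \<open>
  The proof is by induction on \<open>A\<close>: each transition of \<open>(\<Gamma>\<^sub>1; A)\<close> exposes the premises of
  the right rule for \<open>A\<close>, and the internal moves with which \<open>(\<Gamma>\<^sub>2; \<Delta>)\<close> answers are undone by
  left rules, because derivability is preserved backwards along internal transitions.
\<close>

text \<open>Every rule leaves the unrestricted context arbitrary, and \<open>clone\<close> only asks
  that one formula occur in it, so extra formulas pass through a derivation untouched. This is what
  bridges contexts that differ in multiplicity or come from different states.\<close>

lemma derivable_weaken:
  assumes "derivable \<Gamma> \<Delta> C" "\<Gamma> \<subseteq># \<Gamma>'"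
  shows "derivable \<Gamma>' \<Delta> C"
  using assms
proof (induction arbitrary: \<Gamma>' rule: derivable.induct)
  case (clone A \<Gamma> \<Delta> C)
  then obtain \<Gamma>'' where "\<Gamma>' = add_mset A \<Gamma>''"
    by (meson insert_subset_eq_iff mset_add)
  with clone show ?case by (auto intro: derivable.clone)
next
  case (bangL A \<Gamma> \<Delta> C)
  then show ?case by (auto intro: derivable.bangL)
qed (simp_all add: derivable.intros(1,3-14))

text \<open>States carry a set of unrestricted formulas, sequents a multiset;
  \<open>mset_set\<close> picks the representative in which each formula occurs once.\<close>

abbreviation derivable_from :: "'a state \<Rightarrow> 'a form \<Rightarrow> bool" where
  "derivable_from S \<equiv> derivable (mset_set (fset (fst S))) (snd S)"

lemma step_OutD:
  assumes "step S (Out a) T"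
  shows "fst T = fst S" "snd S = add_mset (Atom a) (snd T)"
  using assms by (auto elim: step.cases)

lemma step_InE:
  assumes "step S (In a) T"
  obtains B \<Delta> where "fst T = fst S" "snd S = add_mset (Lolli a B) \<Delta>" "snd T = add_mset B \<Delta>"
  using assms by (auto elim: step.cases)

text \<open>Each internal transition is a left rule read from conclusion to premise;
  \<open>copy\<close> is \<open>clone\<close>, and \<open>sync\<close> is \<open>lolliL\<close>
  whose minor premise is the axiom on the exchanged atom.\<close>

lemma derivable_step_Tau:
  assumes "step S Tau T" "derivable_from T C"
  shows "derivable_from S C"
  using assms
proof (induction S "Tau :: 'a label" T rule: step.induct)
  case (sync S\<^sub>1 a S\<^sub>1' S\<^sub>2 S\<^sub>2')
  obtain B \<Delta> where B: "fst S\<^sub>2' = fst S\<^sub>2" "snd S\<^sub>2 = add_mset (Lolli a B) \<Delta>" "snd S\<^sub>2' = add_mset B \<Delta>"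
    using sync step_InE by metis
  have O: "fst S\<^sub>1' = fst S\<^sub>1" "snd S\<^sub>1 = add_mset (Atom a) (snd S\<^sub>1')"
    using sync step_OutD by metis+
  show ?case
    using sync.prems B O
      derivable.lolliL[OF derivable.init[of _ a], of _ B "snd S\<^sub>1' + \<Delta>" C]
    by (simp add: compose_def add_mset_commute)
next
  case (bang \<Gamma> A \<Delta>)
  \<comment> \<open>Only an inclusion: if A is already in \<Gamma>, \<open>finsert\<close> adds
    nothing, while the premise of \<open>bangL\<close> has one more copy of A.\<close>
  have "mset_set (fset (finsert A \<Gamma>)) \<subseteq># add_mset A (mset_set (fset \<Gamma>))"
    by (cases "A |\<in>| \<Gamma>") (auto simp: insert_absorb)
  with bang show ?case
    by (auto intro: derivable.bangL derivable_weaken)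
next
  case (copy A \<Gamma> \<Delta>)
  then obtain \<Theta> where "mset_set (fset (finsert A \<Gamma>)) = add_mset A \<Theta>"
    by (metis finite_fset finsertI1 elem_mset_set mset_add)
  with copy show ?case by (auto intro: derivable.clone)
qed (simp_all add: derivable.intros(1,3-14))

lemma derivable_tau_steps:
  assumes "tau_steps S T" "derivable_from T C"
  shows "derivable_from S C"
  using assms unfolding tau_steps_def
  by (induction rule: converse_rtranclp_induct) (auto dest: derivable_step_Tau)

lemma step_frame:
  assumes "step S l T"
  shows "step (fst S, add_mset X (snd S)) l (fst T, add_mset X (snd T))"
  using assms
proof (induction rule: step.induct)
  case (sync S\<^sub>1 a S\<^sub>1' S\<^sub>2 S\<^sub>2')
  \<comment> \<open>The spectator X can travel with only one of the two components; here it joins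
    the receiver.\<close>
  from step.sync[OF sync.hyps(1) sync.IH(2)] show ?case by (simp add: compose_def)
next
  case (out \<Gamma> a \<Delta>)
  from step.out[of \<Gamma> a "add_mset X \<Delta>"] show ?case by (simp add: add_mset_commute)
next
  case (inp \<Gamma> a B \<Delta>)
  from step.inp[of \<Gamma> a B "add_mset X \<Delta>"] show ?case by (simp add: add_mset_commute)
next
  case (tensor \<Gamma> A B \<Delta>)
  from step.tensor[of \<Gamma> A B "add_mset X \<Delta>"] show ?case by (simp add: add_mset_commute)
next
  case (one \<Gamma> \<Delta>)
  from step.one[of \<Gamma> "add_mset X \<Delta>"] show ?case by (simp add: add_mset_commute)
next
  case (with1 \<Gamma> A\<^sub>1 A\<^sub>2 \<Delta>)
  from step.with1[of \<Gamma> A\<^sub>1 A\<^sub>2 "add_mset X \<Delta>"] show ?case by (simp add: add_mset_commute)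
next
  case (with2 \<Gamma> A\<^sub>1 A\<^sub>2 \<Delta>)
  from step.with2[of \<Gamma> A\<^sub>1 A\<^sub>2 "add_mset X \<Delta>"] show ?case by (simp add: add_mset_commute)
next
  case (bang \<Gamma> A \<Delta>)
  from step.bang[of \<Gamma> A "add_mset X \<Delta>"] show ?case by (simp add: add_mset_commute)
next
  case (copy A \<Gamma> \<Delta>)
  from step.copy[of A \<Gamma> "add_mset X \<Delta>"] show ?case by (simp add: add_mset_commute)
qed

lemma tau_steps_frame:
  assumes "tau_steps S T"
  shows "tau_steps (fst S, add_mset X (snd S)) (fst T, add_mset X (snd T))"
  using assms unfolding tau_steps_def
  by (induction rule: rtranclp_induct) (auto dest: step_frame intro: rtranclp.rtrancl_into_rtrancl)

context
  fixes R :: "'a state \<Rightarrow> 'a state \<Rightarrow> bool" and S T :: "'a state"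
  assumes sim: "simulation R" and rel: "R S T"
begin

text \<open>The definition quantifies over the components of the states; instantiating with
  projections and folding the pairs back yields clauses about \<open>S\<close> and \<open>T\<close>
  themselves.\<close>

lemmas simulation_clauses = sim[unfolded simulation_def, THEN spec, of "fst S", THEN spec, of "snd S",
    THEN spec, of "fst T", THEN spec, of "snd T", unfolded prod.collapse, THEN mp, OF rel]

lemma simulation_emptyE:
  assumes "S = (\<Gamma>, {#})"
  obtains \<Gamma>' where "tau_steps T (\<Gamma>', {#})" "R (\<Gamma>, {#}) (\<Gamma>', {#})"
  using simulation_clauses[THEN conjunct1] assms by blast

lemma simulation_composeE:
  assumes "S = compose S\<^sub>1 S\<^sub>2"
  obtains T\<^sub>1 T\<^sub>2 where "tau_steps T (compose T\<^sub>1 T\<^sub>2)" "R S\<^sub>1 T\<^sub>1" "R S\<^sub>2 T\<^sub>2"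
  using simulation_clauses[THEN conjunct2, THEN conjunct1] assms by blast

lemma simulation_tauE:
  assumes "step S Tau S'"
  obtains T' where "tau_steps T T'" "R S' T'"
proof -
  have "\<exists>T'. weak_step T Tau T' \<and> R S' T'"
    using simulation_clauses[THEN conjunct2, THEN conjunct2, THEN conjunct1, THEN spec, of Tau] assms
    by blast
  with that show ?thesis by (auto simp: weak_step_def)
qed

lemma simulation_outE:
  assumes "step S (Out a) S'"
  obtains U U' T' where "tau_steps T U" "step U (Out a) U'" "tau_steps U' T'" "R S' T'"
proof -
  have "\<exists>T'. weak_step T (Out a) T' \<and> R S' T'"
    using simulation_clauses[THEN conjunct2, THEN conjunct2, THEN conjunct1, THEN spec, of "Out a"] assms
    by blast
  with that show ?thesis by (auto simp: weak_step_def)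
qed

lemma simulation_inE:
  assumes "step S (In a) S'"
  obtains T' where "tau_steps (fst T, add_mset (Atom a) (snd T)) T'" "R S' T'"
  using simulation_clauses[THEN conjunct2, THEN conjunct2, THEN conjunct2] assms by blast

end

text \<open>The set \<Gamma> and the state T must vary in the induction: every answer replaces T,
  and the case of \<open>Bang\<close> also enlarges \<Gamma>.\<close>

lemma simulation_derivable:
  assumes "simulation R" "R (\<Gamma>, {#A#}) T"
  shows "derivable_from T A"
  using assms(2)
proof (induction A arbitrary: \<Gamma> T)
  case (Atom a)
  from simulation_outE[OF assms(1) Atom step.out]
  obtain U U' T' where U: "tau_steps T U" "step U (Out a) U'" "tau_steps U' T'" "R (\<Gamma>, {#}) T'" .
  from simulation_emptyE[OF assms(1) U(4) refl]
  obtain \<Gamma>' where "tau_steps T' (\<Gamma>', {#})" .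
  with U(3) have "tau_steps U' (\<Gamma>', {#})"
    by (simp add: tau_steps_def)
  \<comment> \<open>The output is not performed: U is U' plus the atom, so the run that empties U'
    takes U to the atom alone, where \<open>init\<close> applies.\<close>
  from tau_steps_frame[OF this, of "Atom a"] step_OutD[OF U(2)]
  have "tau_steps U (\<Gamma>', {#Atom a#})"
    by (metis fst_conv snd_conv prod.collapse)
  then have "derivable_from U (Atom a)"
    by (rule derivable_tau_steps) (simp add: derivable.init)
  with U(1) show ?case by (rule derivable_tau_steps)
next
  case One
  from simulation_tauE[OF assms(1) One step.one]
  obtain T' where T': "tau_steps T T'" "R (\<Gamma>, {#}) T'" .
  from simulation_emptyE[OF assms(1) T'(2) refl]
  obtain \<Gamma>' where "tau_steps T' (\<Gamma>', {#})" .
  then have "derivable_from T' One"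
    by (rule derivable_tau_steps) (simp add: derivable.oneR)
  with T'(1) show ?case by (rule derivable_tau_steps)
next
  case (Tensor A B)
  from simulation_tauE[OF assms(1) Tensor.prems step.tensor]
  obtain T' where T': "tau_steps T T'" "R (\<Gamma>, {#} + {#A, B#}) T'" .
  \<comment> \<open>Unrestricted parts are united, so both components may keep all of
    \<Gamma>.\<close>
  then have "R (compose (\<Gamma>, {#A#}) (\<Gamma>, {#B#})) T'"
    by (simp add: compose_def add_mset_commute)
  from simulation_composeE[OF assms(1) this refl] obtain T\<^sub>1 T\<^sub>2
    where C: "tau_steps T' (compose T\<^sub>1 T\<^sub>2)" "R (\<Gamma>, {#A#}) T\<^sub>1" "R (\<Gamma>, {#B#}) T\<^sub>2" .
  \<comment> \<open>\<open>tensorR\<close> needs one unrestricted context for both premises, so each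
    is weakened to that of the composition.\<close>
  let ?G = "mset_set (fset (fst T\<^sub>1) \<union> fset (fst T\<^sub>2))"
  have "derivable ?G (snd T\<^sub>1) A"
    using Tensor.IH(1)[OF C(2)] by (rule derivable_weaken) (simp add: subset_imp_msubset_mset_set)
  moreover have "derivable ?G (snd T\<^sub>2) B"
    using Tensor.IH(2)[OF C(3)] by (rule derivable_weaken) (simp add: subset_imp_msubset_mset_set)
  ultimately have "derivable_from (compose T\<^sub>1 T\<^sub>2) (Tensor A B)"
    by (simp add: compose_def derivable.tensorR)
  with C(1) T'(1) show ?case by (blast intro: derivable_tau_steps)
next
  case Top
  show ?case by (rule derivable.topR)
next
  case (With A B)
  from simulation_tauE[OF assms(1) With.prems step.with1]
  obtain T\<^sub>1 where 1: "tau_steps T T\<^sub>1" "R (\<Gamma>, {#A#}) T\<^sub>1" .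
  from simulation_tauE[OF assms(1) With.prems step.with2]
  obtain T\<^sub>2 where 2: "tau_steps T T\<^sub>2" "R (\<Gamma>, {#B#}) T\<^sub>2" .
  show ?case
    using 1 2 With.IH by (blast intro: derivable.withR derivable_tau_steps)
next
  case (Lolli a B)
  from simulation_inE[OF assms(1) Lolli.prems step.inp] obtain T'
    where "tau_steps (fst T, add_mset (Atom a) (snd T)) T'" "R (\<Gamma>, {#B#}) T'" .
  \<comment> \<open>The atom that the input clause adds to T is the hypothesis discharged by
    \<open>lolliR\<close>.\<close>
  from derivable_tau_steps[OF this(1) Lolli.IH[OF this(2)]]
  show ?case by (simp add: derivable.lolliR)
next
  case (Bang A)
  from simulation_tauE[OF assms(1) Bang.prems step.bang]
  obtain T' where T': "tau_steps T T'" "R (finsert A \<Gamma>, {#}) T'" .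
  \<comment> \<open>\<open>bangR\<close> demands an empty linear context, so the answering state is
    emptied before A is copied back out of the unrestricted part.\<close>
  from simulation_emptyE[OF assms(1) T'(2) refl] obtain \<Gamma>'
    where G: "tau_steps T' (\<Gamma>', {#})" "R (finsert A \<Gamma>, {#}) (\<Gamma>', {#})" .
  from simulation_tauE[OF assms(1) G(2) step.copy] obtain T''
    where "tau_steps (\<Gamma>', {#}) T''" "R (finsert A \<Gamma>, {#A#}) T''" .
  from derivable_tau_steps[OF this(1) Bang.IH[OF this(2)]]
  have "derivable_from (\<Gamma>', {#}) (Bang A)"
    by (simp add: derivable.bangR)
  with G(1) T'(1) show ?case by (blast intro: derivable_tau_steps)
qed

theorem theorem3:
  fixes \<Gamma>\<^sub>1 \<Gamma>\<^sub>2 :: "'a form fset" and \<Delta> :: "'a form multiset" and A :: "'a form"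
  assumes "(\<Gamma>\<^sub>1, {#A#}) \<preceq>\<^sub>s (\<Gamma>\<^sub>2, \<Delta>)"
  shows "derivable (mset_set (fset \<Gamma>\<^sub>2)) \<Delta> A"
  using assms simulation_derivable[of _ \<Gamma>\<^sub>1 A "(\<Gamma>\<^sub>2, \<Delta>)"]
  unfolding sim_preorder_def by auto

end
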